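(* Let $\mathscr C$ be a category with pullbacks. Then $\mathscr C$ is adhesive if and only if $\mathscr C$ has pushouts along monomorphisms, and these pushouts are stable and are pullbacks.
   Context: A pushout along a monomorphism is a pushout square $C\xrightarrow{m}A\xrightarrow{g}D$, $C\xrightarrow{f}B\xrightarrow{n}D$ with $gm=nf$ in which $m$ is a monomorphism and $f$ is arbitrary. "Has pushouts along monomorphisms" means that the pushout of $m$ along $f$ exists for every monomorphism $m\colon C\to A$ and every $f\colon C\to B$. A pushout square with vertex $D$ is stable if, for every morphism $d\colon D'\to D$, pulling back the whole square along $d$ yields again a pushout square. A pushout square $gm=nf$ (with $m\colon C\to A$, $f\colon C\to B$, $g\colon A\to D$, $n\colon B\to D$) is van Kampen if for every commutative cube having this square as bottom face, with top face $g'm'=n'f'$ ($m'\colon C'\to A'$, $f'\colon C'\to B'$, $g'\colon A'\to D'$, $n'\colon B'\to D'$) and vertical maps $a\colon A'\to A$, $b\colon B'\to B$, $c\colon C'\to C$, $d\colon D'\to D$, such that the left face ($am'=mc$) and back face ($bf'=fc$) are pullbacks, the following holds: the top face is a pushout if and only if the front face ($dg'=ga$) and right face ($dn'=nb$) are pullbacks. A category with pullbacks is adhesive if it has pushouts along monomorphisms and these are van Kampen. *)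

theory Defs
  imports Main
begin

record ('o, 'm) category_data =
  Obj :: "'o set"
  Arr :: "'m set"
  Dom :: "'m \<Rightarrow> 'o"
  Cod :: "'m \<Rightarrow> 'o"
  Id :: "'o \<Rightarrow> 'm"
  Comp :: "'m \<Rightarrow> 'm \<Rightarrow> 'm"  (infixr \<open>\<cdot>\<index>\<close> 70)

definition hom_set :: "('o, 'm, 'z) category_data_scheme \<Rightarrow> 'o \<Rightarrow> 'o \<Rightarrow> 'm set" where
  "hom_set C x y = {f \<in> Arr C. Dom C f = x \<and> Cod C f = y}"

text \<open>Composition is written in the applicative order, and its value on
  non-composable pairs is left unspecified.\<close>

locale category =
  fixes C :: "('o, 'm, 'z) category_data_scheme" (structure)
  assumes Dom_in_Obj: "f \<in> Arr C \<Longrightarrow> Dom C f \<in> Obj C"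
    and Cod_in_Obj: "f \<in> Arr C \<Longrightarrow> Cod C f \<in> Obj C"
    and Id_in_hom: "x \<in> Obj C \<Longrightarrow> Id C x \<in> hom_set C x x"
    and Comp_in_hom: "\<lbrakk>f \<in> hom_set C x y; g \<in> hom_set C y z\<rbrakk> \<Longrightarrow> g \<cdot> f \<in> hom_set C x z"
    and Comp_Id_right: "f \<in> Arr C \<Longrightarrow> f \<cdot> Id C (Dom C f) = f"
    and Comp_Id_left: "f \<in> Arr C \<Longrightarrow> Id C (Cod C f) \<cdot> f = f"
    and Comp_assoc:
      "\<lbrakk>f \<in> hom_set C w x; g \<in> hom_set C x y; h \<in> hom_set C y z\<rbrakk> \<Longrightarrow> (h \<cdot> g) \<cdot> f = h \<cdot> (g \<cdot> f)"

definition monic :: "('o, 'm, 'z) category_data_scheme \<Rightarrow> 'm \<Rightarrow> bool" where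
  "monic C m \<longleftrightarrow> m \<in> Arr C \<and>
    (\<forall>u v. u \<in> Arr C \<and> v \<in> Arr C \<and> Dom C u = Dom C v \<and> Cod C u = Dom C m \<and> Cod C v = Dom C m
      \<and> m \<cdot>\<^bsub>C\<^esub> u = m \<cdot>\<^bsub>C\<^esub> v \<longrightarrow> u = v)"

text \<open>A square is given by its four sides \<open>m f g n\<close>, where \<open>m\<close> and \<open>f\<close> leave the initial
  corner, \<open>g\<close> follows \<open>m\<close> and \<open>n\<close> follows \<open>f\<close>; the corners are recovered from the domains and
  codomains. The same order of sides is used for pushouts and pullbacks.\<close>

definition comm_square ::
    "('o, 'm, 'z) category_data_scheme \<Rightarrow> 'm \<Rightarrow> 'm \<Rightarrow> 'm \<Rightarrow> 'm \<Rightarrow> bool" where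
  "comm_square C m f g n \<longleftrightarrow>
    m \<in> Arr C \<and> f \<in> Arr C \<and> g \<in> Arr C \<and> n \<in> Arr C \<and>
    Dom C m = Dom C f \<and> Cod C m = Dom C g \<and> Cod C f = Dom C n \<and> Cod C g = Cod C n \<and>
    g \<cdot>\<^bsub>C\<^esub> m = n \<cdot>\<^bsub>C\<^esub> f"

definition is_pushout ::
    "('o, 'm, 'z) category_data_scheme \<Rightarrow> 'm \<Rightarrow> 'm \<Rightarrow> 'm \<Rightarrow> 'm \<Rightarrow> bool" where
  "is_pushout C m f g n \<longleftrightarrow> comm_square C m f g n \<and>
    (\<forall>h k. comm_square C m f h k \<longrightarrow>
      (\<exists>!u. u \<in> hom_set C (Cod C g) (Cod C h) \<and> u \<cdot>\<^bsub>C\<^esub> g = h \<and> u \<cdot>\<^bsub>C\<^esub> n = k))"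

definition is_pullback ::
    "('o, 'm, 'z) category_data_scheme \<Rightarrow> 'm \<Rightarrow> 'm \<Rightarrow> 'm \<Rightarrow> 'm \<Rightarrow> bool" where
  "is_pullback C p q g n \<longleftrightarrow> comm_square C p q g n \<and>
    (\<forall>h k. comm_square C h k g n \<longrightarrow>
      (\<exists>!u. u \<in> hom_set C (Dom C h) (Dom C p) \<and> p \<cdot>\<^bsub>C\<^esub> u = h \<and> q \<cdot>\<^bsub>C\<^esub> u = k))"

definition has_pullbacks :: "('o, 'm, 'z) category_data_scheme \<Rightarrow> bool" where
  "has_pullbacks C \<longleftrightarrow>
    (\<forall>g n. g \<in> Arr C \<and> n \<in> Arr C \<and> Cod C g = Cod C n \<longrightarrow> (\<exists>p q. is_pullback C p q g n))"

definition has_pushouts_along_monos :: "('o, 'm, 'z) category_data_scheme \<Rightarrow> bool" where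
  "has_pushouts_along_monos C \<longleftrightarrow>
    (\<forall>m f. monic C m \<and> f \<in> Arr C \<and> Dom C f = Dom C m \<longrightarrow> (\<exists>g n. is_pushout C m f g n))"

text \<open>Pulling back a square with vertex \<open>D\<close> along \<open>d : D' \<rightarrow> D\<close> means pulling back its other
  three corners, regarded as objects over \<open>D\<close> via \<open>g\<close>, \<open>n\<close> and \<open>g \<cdot> m\<close> (\<open>= n \<cdot> f\<close>), and taking
  the induced maps \<open>m'\<close> and \<open>f'\<close> over \<open>D'\<close>. Here \<open>g'\<close>, \<open>n'\<close> and \<open>e\<close> are the projections to \<open>D'\<close>,
  while \<open>a\<close>, \<open>b\<close> and \<open>c\<close> are the projections to the corners of the original square. All choices
  of the pullbacks are considered.\<close>

definition stable_pushout ::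
    "('o, 'm, 'z) category_data_scheme \<Rightarrow> 'm \<Rightarrow> 'm \<Rightarrow> 'm \<Rightarrow> 'm \<Rightarrow> bool" where
  "stable_pushout C m f g n \<longleftrightarrow> is_pushout C m f g n \<and>
    (\<forall>d g' a n' b e c m' f'.
      is_pullback C g' a d g \<and> is_pullback C n' b d n \<and> is_pullback C e c d (g \<cdot>\<^bsub>C\<^esub> m) \<and>
      m' \<in> hom_set C (Dom C c) (Dom C a) \<and> g' \<cdot>\<^bsub>C\<^esub> m' = e \<and> a \<cdot>\<^bsub>C\<^esub> m' = m \<cdot>\<^bsub>C\<^esub> c \<and>
      f' \<in> hom_set C (Dom C c) (Dom C b) \<and> n' \<cdot>\<^bsub>C\<^esub> f' = e \<and> b \<cdot>\<^bsub>C\<^esub> f' = f \<cdot>\<^bsub>C\<^esub> c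
      \<longrightarrow> is_pushout C m' f' g' n')"

text \<open>Bottom face \<open>m f g n\<close>, top face \<open>m' f' g' n'\<close>, vertical maps \<open>a b c d\<close>; the last four
  conjuncts are the left, back, front and right faces.\<close>

definition comm_cube ::
    "('o, 'm, 'z) category_data_scheme \<Rightarrow> 'm \<Rightarrow> 'm \<Rightarrow> 'm \<Rightarrow> 'm \<Rightarrow> 'm \<Rightarrow> 'm \<Rightarrow> 'm \<Rightarrow> 'm \<Rightarrow>
      'm \<Rightarrow> 'm \<Rightarrow> 'm \<Rightarrow> 'm \<Rightarrow> bool" where
  "comm_cube C m f g n m' f' g' n' a b c d \<longleftrightarrow>
    comm_square C m f g n \<and> comm_square C m' f' g' n' \<and>
    comm_square C m' c a m \<and> comm_square C f' c b f \<and>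
    comm_square C g' a d g \<and> comm_square C n' b d n"

definition van_kampen ::
    "('o, 'm, 'z) category_data_scheme \<Rightarrow> 'm \<Rightarrow> 'm \<Rightarrow> 'm \<Rightarrow> 'm \<Rightarrow> bool" where
  "van_kampen C m f g n \<longleftrightarrow> is_pushout C m f g n \<and>
    (\<forall>m' f' g' n' a b c d.
      comm_cube C m f g n m' f' g' n' a b c d \<and> is_pullback C m' c a m \<and> is_pullback C f' c b f
      \<longrightarrow> (is_pushout C m' f' g' n' \<longleftrightarrow> is_pullback C g' a d g \<and> is_pullback C n' b d n))"

definition adhesive :: "('o, 'm, 'z) category_data_scheme \<Rightarrow> bool" where
  "adhesive C \<longleftrightarrow> has_pullbacks C \<and> has_pushouts_along_monos C \<and>
    (\<forall>m f g n. monic C m \<and> is_pushout C m f g n \<longrightarrow> van_kampen C m f g n)"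

end

theory Submission imports Defs begin

text \<open>
  An adhesive category has stable pushouts along monomorphisms because the pullback of a square
  along an arrow into its vertex is the top of a cube whose four vertical faces are pullbacks
  (\<open>van_kampen_stable\<close>). These pushouts are pullbacks because the square
  \<open>m f g n\<close> itself occurs as a face of the cube standing on \<open>m f g n\<close> whose top is the trivial
  pushout of \<open>f\<close> along an identity (\<open>van_kampen_pullback\<close>).

  For the converse, take a cube over a pushout \<open>m f g n\<close> with \<open>m\<close> monic, whose left and back faces
  are pullbacks and whose top face is a pushout; front and right faces must be shown to be
  pullbacks. In both cases the comparison arrow \<open>s\<close>, from the corner of the cube into the actual
  pullback \<open>Q\<close>, is inverted as follows. The top face is itself a pushout along a monomorphism,
  hence stable, and it is pulled back along the projection \<open>Q \<rightarrow> D'\<close>. If \<open>s\<close> turns out to be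
  a pushout of an identity, it is an isomorphism.

  For the right face this works at once, since \<open>n\<close> is monic (\<open>pushout_monic\<close>). For the front
  face the arrow \<open>g\<close> need not be monic, and the pulled back square has the kernel pair \<open>Z\<close> of
  \<open>f'\<close> and the object \<open>Y = A' \<times>\<^sub>D A\<close> as corners, so that it exhibits \<open>Q\<close> as a pushout of \<open>Y\<close>
  and \<open>X'\<close> under \<open>Z\<close>. The missing ingredient is that \<open>Y\<close> is in turn a pushout of \<open>Z\<close> and \<open>A'\<close> under
  \<open>X'\<close>; pasting the two pushouts shows that \<open>s\<close> is a pushout of an identity.
  This ingredient is a pullback of the statement \<open>kernel_pair_pushout\<close>: the
  kernel pair of \<open>g\<close> is the union of the kernel pair of \<open>f\<close> and the diagonal of \<open>A\<close>, glued along
  the diagonal of \<open>X\<close>. It rests on the fact that the union of two subobjects, formed as the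
  pushout over their intersection, is again a subobject (\<open>union_monic\<close>).

  Pushout lemmas are obtained from pullback lemmas in the opposite category.
\<close>

section \<open>Arrows and duality\<close>

definition iso_arr :: "('o, 'm, 'z) category_data_scheme \<Rightarrow> 'm \<Rightarrow> bool" where
  "iso_arr C s \<longleftrightarrow> s \<in> Arr C \<and> (\<exists>t \<in> hom_set C (Cod C s) (Dom C s).
    t \<cdot>\<^bsub>C\<^esub> s = Id C (Dom C s) \<and> s \<cdot>\<^bsub>C\<^esub> t = Id C (Cod C s))"

definition opposite :: "('o, 'm, 'z) category_data_scheme \<Rightarrow> ('o, 'm, 'z) category_data_scheme" where
  "opposite C = C\<lparr>Dom := Cod C, Cod := Dom C, Comp := (\<lambda>g f. f \<cdot>\<^bsub>C\<^esub> g)\<rparr>"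

lemma opposite_simps [simp]:
  "Obj (opposite C) = Obj C" "Arr (opposite C) = Arr C" "Id (opposite C) = Id C"
  "Dom (opposite C) = Cod C" "Cod (opposite C) = Dom C"
  "g \<cdot>\<^bsub>opposite C\<^esub> f = f \<cdot>\<^bsub>C\<^esub> g"
  "hom_set (opposite C) x y = hom_set C y x"
  by (auto simp: opposite_def hom_set_def)

lemma comm_square_opposite: "comm_square (opposite C) g n m f \<longleftrightarrow> comm_square C m f g n"
  by (auto simp: comm_square_def)

lemma pullback_opposite: "is_pullback (opposite C) g n m f \<longleftrightarrow> is_pushout C m f g n"
  by (simp add: is_pullback_def is_pushout_def comm_square_opposite)

lemma iso_opposite: "iso_arr (opposite C) s \<longleftrightarrow> iso_arr C s"
  by (auto simp: iso_arr_def)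

context category
begin

abbreviation in_hom (\<open>\<guillemotleft>_ : _ \<rightarrow> _\<guillemotright>\<close>) where
  "\<guillemotleft>f : x \<rightarrow> y\<guillemotright> \<equiv> f \<in> hom_set C x y"

lemma comp_simps [simp]:
  assumes "f \<in> Arr C" "g \<in> Arr C" "Cod C f = Dom C g"
  shows "g \<cdot> f \<in> Arr C" "Dom C (g \<cdot> f) = Dom C f" "Cod C (g \<cdot> f) = Cod C g"
  using Comp_in_hom[of f "Dom C f" "Cod C f" g "Cod C g"] assms by (auto simp: hom_set_def)

lemma comp_assoc_simp [simp]:
  assumes "f \<in> Arr C" "g \<in> Arr C" "h \<in> Arr C" "Cod C f = Dom C g" "Cod C g = Dom C h"
  shows "(h \<cdot> g) \<cdot> f = h \<cdot> (g \<cdot> f)"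
  using Comp_assoc[of f "Dom C f" "Cod C f" g "Cod C g" h "Cod C h"] assms
  by (auto simp: hom_set_def)

lemma id_simps [simp]:
  assumes "x \<in> Obj C"
  shows "Id C x \<in> Arr C" "Dom C (Id C x) = x" "Cod C (Id C x) = x"
  using Id_in_hom[OF assms] by (auto simp: hom_set_def)

lemma comp_id_simps [simp]:
  assumes "f \<in> Arr C"
  shows "Dom C f = x \<Longrightarrow> f \<cdot> Id C x = f" "Cod C f = x \<Longrightarrow> Id C x \<cdot> f = f"
  using assms Comp_Id_left Comp_Id_right by auto

lemma obj_simps [simp]: "f \<in> Arr C \<Longrightarrow> Dom C f \<in> Obj C" "f \<in> Arr C \<Longrightarrow> Cod C f \<in> Obj C"
  by (auto intro: Dom_in_Obj Cod_in_Obj)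

lemma hom_obj: "\<guillemotleft>f : x \<rightarrow> y\<guillemotright> \<Longrightarrow> x \<in> Obj C" "\<guillemotleft>f : x \<rightarrow> y\<guillemotright> \<Longrightarrow> y \<in> Obj C"
  by (auto simp: hom_set_def)

lemma comp_eq_comp:
  assumes "g \<cdot> m = n \<cdot> f" "\<guillemotleft>m : x \<rightarrow> y\<guillemotright>" "\<guillemotleft>g : y \<rightarrow> z\<guillemotright>" "\<guillemotleft>f : x \<rightarrow> y'\<guillemotright>" "\<guillemotleft>n : y' \<rightarrow> z\<guillemotright>" "\<guillemotleft>u : w \<rightarrow> x\<guillemotright>"
  shows "g \<cdot> (m \<cdot> u) = n \<cdot> (f \<cdot> u)"
proof -
  have "(g \<cdot> m) \<cdot> u = (n \<cdot> f) \<cdot> u" by (simp only: assms(1))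
  with assms(2-) show ?thesis by (simp add: hom_set_def)
qed

lemma comp_eq_arr:
  assumes "g \<cdot> m = h" "\<guillemotleft>m : x \<rightarrow> y\<guillemotright>" "\<guillemotleft>g : y \<rightarrow> z\<guillemotright>" "\<guillemotleft>u : w \<rightarrow> x\<guillemotright>"
  shows "g \<cdot> (m \<cdot> u) = h \<cdot> u"
  using assms by (auto simp: hom_set_def)

text \<open>The simplifier normalises composites by associating to the right, so an equation \<open>g \<cdot> m = h\<close>
  no longer matches inside a longer composite. The following form of the equation does, and its side
  conditions have no variables that matching leaves open.\<close>

lemma comp_ext:
  assumes "g \<cdot> m = h" "m \<in> Arr C" "g \<in> Arr C" "Cod C m = Dom C g" "u \<in> Arr C" "Cod C u = Dom C m"
  shows "g \<cdot> (m \<cdot> u) = h \<cdot> u"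
  using assms by auto

lemma category_opposite: "category (opposite C)"
  by unfold_locales (auto simp: hom_set_def)

section \<open>Calculus of pullbacks and pushouts\<close>

lemma pullbackI:
  assumes "\<guillemotleft>p : P \<rightarrow> A\<guillemotright>" "\<guillemotleft>q : P \<rightarrow> B\<guillemotright>" "\<guillemotleft>g : A \<rightarrow> D\<guillemotright>" "\<guillemotleft>n : B \<rightarrow> D\<guillemotright>" "g \<cdot> p = n \<cdot> q"
    and lift: "\<And>T h k. \<guillemotleft>h : T \<rightarrow> A\<guillemotright> \<Longrightarrow> \<guillemotleft>k : T \<rightarrow> B\<guillemotright> \<Longrightarrow> g \<cdot> h = n \<cdot> k \<Longrightarrow>
      \<exists>u. \<guillemotleft>u : T \<rightarrow> P\<guillemotright> \<and> p \<cdot> u = h \<and> q \<cdot> u = k"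
    and joint: "\<And>T u v. \<guillemotleft>u : T \<rightarrow> P\<guillemotright> \<Longrightarrow> \<guillemotleft>v : T \<rightarrow> P\<guillemotright> \<Longrightarrow> p \<cdot> u = p \<cdot> v \<Longrightarrow> q \<cdot> u = q \<cdot> v \<Longrightarrow> u = v"
  shows "is_pullback C p q g n"
  unfolding is_pullback_def
proof (intro conjI allI impI)
  show "comm_square C p q g n" using assms(1-5) by (simp add: comm_square_def hom_set_def)
  fix h k assume "comm_square C h k g n"
  then have hk: "\<guillemotleft>h : Dom C h \<rightarrow> A\<guillemotright>" "\<guillemotleft>k : Dom C h \<rightarrow> B\<guillemotright>" "g \<cdot> h = n \<cdot> k"
    using assms(3,4) by (auto simp: comm_square_def hom_set_def)
  have P: "Dom C p = P" using assms(1) by (simp add: hom_set_def)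
  show "\<exists>!u. u \<in> hom_set C (Dom C h) (Dom C p) \<and> p \<cdot> u = h \<and> q \<cdot> u = k"
    unfolding P
  proof (rule ex_ex1I)
    show "\<exists>u. \<guillemotleft>u : Dom C h \<rightarrow> P\<guillemotright> \<and> p \<cdot> u = h \<and> q \<cdot> u = k" by (rule lift[OF hk])
  qed (metis joint)
qed

lemma comm_squareE:
  assumes "comm_square C m f g n"
  obtains X A B D where "\<guillemotleft>m : X \<rightarrow> A\<guillemotright>" "\<guillemotleft>f : X \<rightarrow> B\<guillemotright>" "\<guillemotleft>g : A \<rightarrow> D\<guillemotright>" "\<guillemotleft>n : B \<rightarrow> D\<guillemotright>" "g \<cdot> m = n \<cdot> f"
  using assms that[of "Dom C m" "Dom C g" "Dom C n" "Cod C g"]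
  by (auto simp: comm_square_def hom_set_def)

lemma pullbackE:
  assumes "is_pullback C p q g n"
  obtains P A B D where "\<guillemotleft>p : P \<rightarrow> A\<guillemotright>" "\<guillemotleft>q : P \<rightarrow> B\<guillemotright>" "\<guillemotleft>g : A \<rightarrow> D\<guillemotright>" "\<guillemotleft>n : B \<rightarrow> D\<guillemotright>" "g \<cdot> p = n \<cdot> q"
  using assms that[of "Dom C p" "Dom C g" "Dom C n" "Cod C g"]
  by (auto simp: is_pullback_def comm_square_def hom_set_def)

lemma pullback_lift:
  assumes "is_pullback C p q g n" "\<guillemotleft>p : P \<rightarrow> A\<guillemotright>" "\<guillemotleft>q : P \<rightarrow> B\<guillemotright>"
    and "\<guillemotleft>h : T \<rightarrow> A\<guillemotright>" "\<guillemotleft>k : T \<rightarrow> B\<guillemotright>" "g \<cdot> h = n \<cdot> k"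
  obtains u where "\<guillemotleft>u : T \<rightarrow> P\<guillemotright>" "p \<cdot> u = h" "q \<cdot> u = k"
proof -
  have "comm_square C h k g n" using assms by (auto simp: is_pullback_def comm_square_def hom_set_def)
  then have "\<exists>!u. u \<in> hom_set C (Dom C h) (Dom C p) \<and> p \<cdot> u = h \<and> q \<cdot> u = k"
    using assms(1) by (simp add: is_pullback_def)
  moreover have "Dom C h = T" "Dom C p = P" using assms by (auto simp: hom_set_def)
  ultimately show ?thesis using that by auto
qed

lemma pullback_jointly_monic:
  assumes "is_pullback C p q g n" "\<guillemotleft>p : P \<rightarrow> A\<guillemotright>"
    and "\<guillemotleft>u : T \<rightarrow> P\<guillemotright>" "\<guillemotleft>v : T \<rightarrow> P\<guillemotright>" "p \<cdot> u = p \<cdot> v" "q \<cdot> u = q \<cdot> v"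
  shows "u = v"
proof -
  have sq: "p \<in> Arr C" "q \<in> Arr C" "g \<in> Arr C" "n \<in> Arr C" "Dom C p = P" "Dom C q = P"
    "Dom C g = Cod C p" "Dom C n = Cod C q" "Cod C g = Cod C n" "g \<cdot> p = n \<cdot> q"
    using assms by (auto simp: is_pullback_def comm_square_def hom_set_def)
  have uvT: "u \<in> Arr C" "Dom C u = T" "Cod C u = P" using assms by (auto simp: hom_set_def)
  have "g \<cdot> (p \<cdot> u) = n \<cdot> (q \<cdot> u)"
    by (rule comp_eq_comp[OF sq(10)]) (use sq uvT in \<open>auto simp: hom_set_def\<close>)
  then have "comm_square C (p \<cdot> u) (q \<cdot> u) g n" using sq uvT by (simp add: comm_square_def)
  then have "\<exists>!w. w \<in> hom_set C (Dom C (p \<cdot> u)) (Dom C p) \<and> p \<cdot> w = p \<cdot> u \<and> q \<cdot> w = q \<cdot> u"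
    using assms(1) by (simp add: is_pullback_def)
  moreover have "Dom C (p \<cdot> u) = T" using sq uvT by simp
  ultimately have "\<exists>!w. \<guillemotleft>w : T \<rightarrow> P\<guillemotright> \<and> p \<cdot> w = p \<cdot> u \<and> q \<cdot> w = q \<cdot> u" using sq(5) by metis
  with assms(3-6) show ?thesis by metis
qed

lemma monicI:
  assumes "\<guillemotleft>m : x \<rightarrow> y\<guillemotright>" "\<And>T u v. \<guillemotleft>u : T \<rightarrow> x\<guillemotright> \<Longrightarrow> \<guillemotleft>v : T \<rightarrow> x\<guillemotright> \<Longrightarrow> m \<cdot> u = m \<cdot> v \<Longrightarrow> u = v"
  shows "monic C m"
  using assms by (auto simp: monic_def hom_set_def)

lemma monicD:
  assumes "monic C m" "\<guillemotleft>m : x \<rightarrow> y\<guillemotright>" "\<guillemotleft>u : T \<rightarrow> x\<guillemotright>" "\<guillemotleft>v : T \<rightarrow> x\<guillemotright>" "m \<cdot> u = m \<cdot> v"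
  shows "u = v"
  using assms by (auto simp: monic_def hom_set_def)

lemma pullback_swap: "is_pullback C p q g n \<Longrightarrow> is_pullback C q p n g"
  unfolding is_pullback_def comm_square_def by metis

lemma pullback_paste:
  assumes L: "is_pullback C m' c a m" and R: "is_pullback C g' a d g"
  shows "is_pullback C (g' \<cdot> m') c d (g \<cdot> m)"
proof -
  obtain P A X E where t: "\<guillemotleft>m' : P \<rightarrow> A\<guillemotright>" "\<guillemotleft>c : P \<rightarrow> X\<guillemotright>" "\<guillemotleft>a : A \<rightarrow> E\<guillemotright>" "\<guillemotleft>m : X \<rightarrow> E\<guillemotright>" "a \<cdot> m' = m \<cdot> c"
    by (rule pullbackE[OF L])
  obtain Y Z where s: "\<guillemotleft>g' : A \<rightarrow> Y\<guillemotright>" "\<guillemotleft>d : Y \<rightarrow> Z\<guillemotright>" "\<guillemotleft>g : E \<rightarrow> Z\<guillemotright>" "d \<cdot> g' = g \<cdot> a"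
    by (rule pullbackE[OF R]) (use t in \<open>auto simp: hom_set_def\<close>)
  show ?thesis
  proof (rule pullbackI[of _ P Y _ X _ Z])
    show "d \<cdot> g' \<cdot> m' = (g \<cdot> m) \<cdot> c"
      using comp_eq_comp[OF s(4,1,2) t(3) s(3) t(1)] t s by (simp add: hom_set_def)
  next
    fix T h k assume h: "\<guillemotleft>h : T \<rightarrow> Y\<guillemotright>" and k: "\<guillemotleft>k : T \<rightarrow> X\<guillemotright>" and eq: "d \<cdot> h = (g \<cdot> m) \<cdot> k"
    obtain v where v: "\<guillemotleft>v : T \<rightarrow> A\<guillemotright>" "g' \<cdot> v = h" "a \<cdot> v = m \<cdot> k"
      by (rule pullback_lift[OF R s(1) t(3) h, of "m \<cdot> k"]) (use k eq t s in \<open>auto simp: hom_set_def\<close>)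
    obtain u where u: "\<guillemotleft>u : T \<rightarrow> P\<guillemotright>" "m' \<cdot> u = v" "c \<cdot> u = k"
      by (rule pullback_lift[OF L t(1,2) v(1) k v(3)])
    show "\<exists>u. \<guillemotleft>u : T \<rightarrow> P\<guillemotright> \<and> (g' \<cdot> m') \<cdot> u = h \<and> c \<cdot> u = k"
      using u v t s by (intro exI[of _ u]) (auto simp: hom_set_def)
  next
    fix T u v assume u: "\<guillemotleft>u : T \<rightarrow> P\<guillemotright>" and v: "\<guillemotleft>v : T \<rightarrow> P\<guillemotright>" and
      eq: "(g' \<cdot> m') \<cdot> u = (g' \<cdot> m') \<cdot> v" "c \<cdot> u = c \<cdot> v"
    have "m' \<cdot> u = m' \<cdot> v"
    proof (rule pullback_jointly_monic[OF R s(1)])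
      show "g' \<cdot> m' \<cdot> u = g' \<cdot> m' \<cdot> v" using eq u v t s by (simp add: hom_set_def)
      show "a \<cdot> m' \<cdot> u = a \<cdot> m' \<cdot> v"
        using comp_eq_comp[OF t(5,1,3,2,4) u] comp_eq_comp[OF t(5,1,3,2,4) v] eq by simp
    qed (use u v t in \<open>auto simp: hom_set_def\<close>)
    then show "u = v" using pullback_jointly_monic[OF L t(1) u v] eq by simp
  qed (use t s in \<open>auto simp: hom_set_def\<close>)
qed

lemma pullback_cancel:
  assumes R: "is_pullback C g' a d g" and LR: "is_pullback C (g' \<cdot> m') c d (g \<cdot> m)"
    and sq: "comm_square C m' c a m"
  shows "is_pullback C m' c a m"
proof -
  obtain P A X E where t: "\<guillemotleft>m' : P \<rightarrow> A\<guillemotright>" "\<guillemotleft>c : P \<rightarrow> X\<guillemotright>" "\<guillemotleft>a : A \<rightarrow> E\<guillemotright>" "\<guillemotleft>m : X \<rightarrow> E\<guillemotright>" "a \<cdot> m' = m \<cdot> c"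
    by (rule comm_squareE[OF sq])
  obtain Y Z where s: "\<guillemotleft>g' : A \<rightarrow> Y\<guillemotright>" "\<guillemotleft>d : Y \<rightarrow> Z\<guillemotright>" "\<guillemotleft>g : E \<rightarrow> Z\<guillemotright>" "d \<cdot> g' = g \<cdot> a"
    by (rule pullbackE[OF R]) (use t in \<open>auto simp: hom_set_def\<close>)
  have gm: "\<guillemotleft>g' \<cdot> m' : P \<rightarrow> Y\<guillemotright>" using t s by (auto simp: hom_set_def)
  show ?thesis
  proof (rule pullbackI[OF t])
    fix T h k assume h: "\<guillemotleft>h : T \<rightarrow> A\<guillemotright>" and k: "\<guillemotleft>k : T \<rightarrow> X\<guillemotright>" and eq: "a \<cdot> h = m \<cdot> k"
    have "d \<cdot> (g' \<cdot> h) = (g \<cdot> m) \<cdot> k"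
      using comp_eq_comp[OF s(4,1,2) t(3) s(3) h] eq t s k by (simp add: hom_set_def)
    then obtain u where u: "\<guillemotleft>u : T \<rightarrow> P\<guillemotright>" "(g' \<cdot> m') \<cdot> u = g' \<cdot> h" "c \<cdot> u = k"
      using pullback_lift[OF LR gm t(2) _ k, of "g' \<cdot> h"] h s by (auto simp: hom_set_def)
    have "m' \<cdot> u = h"
    proof (rule pullback_jointly_monic[OF R s(1) _ h])
      show "g' \<cdot> m' \<cdot> u = g' \<cdot> h" using u t s by (simp add: hom_set_def)
      show "a \<cdot> m' \<cdot> u = a \<cdot> h" using comp_eq_comp[OF t(5,1,3,2,4) u(1)] u eq by simp
    qed (use u t in \<open>auto simp: hom_set_def\<close>)
    with u show "\<exists>u. \<guillemotleft>u : T \<rightarrow> P\<guillemotright> \<and> m' \<cdot> u = h \<and> c \<cdot> u = k" by blast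
  next
    fix T u v assume u: "\<guillemotleft>u : T \<rightarrow> P\<guillemotright>" and v: "\<guillemotleft>v : T \<rightarrow> P\<guillemotright>" and
      eq: "m' \<cdot> u = m' \<cdot> v" "c \<cdot> u = c \<cdot> v"
    then have "(g' \<cdot> m') \<cdot> u = (g' \<cdot> m') \<cdot> v" using t s by (simp add: hom_set_def)
    then show "u = v" using pullback_jointly_monic[OF LR gm u v] eq by simp
  qed
qed

lemma monic_pullback:
  assumes pb: "is_pullback C m' c a m" and m: "monic C m"
  shows "monic C m'"
proof -
  obtain P A X E where t: "\<guillemotleft>m' : P \<rightarrow> A\<guillemotright>" "\<guillemotleft>c : P \<rightarrow> X\<guillemotright>" "\<guillemotleft>a : A \<rightarrow> E\<guillemotright>" "\<guillemotleft>m : X \<rightarrow> E\<guillemotright>" "a \<cdot> m' = m \<cdot> c"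
    by (rule pullbackE[OF pb])
  show ?thesis
  proof (rule monicI[OF t(1)])
    fix T u v assume u: "\<guillemotleft>u : T \<rightarrow> P\<guillemotright>" and v: "\<guillemotleft>v : T \<rightarrow> P\<guillemotright>" and eq: "m' \<cdot> u = m' \<cdot> v"
    have "m \<cdot> (c \<cdot> u) = m \<cdot> (c \<cdot> v)"
      using comp_eq_comp[OF t(5,1,3,2,4) u] comp_eq_comp[OF t(5,1,3,2,4) v] eq by simp
    then have "c \<cdot> u = c \<cdot> v"
      using monicD[OF m t(4), of "c \<cdot> u" T "c \<cdot> v"] u v t by (auto simp: hom_set_def)
    then show "u = v" using pullback_jointly_monic[OF pb t(1) u v] eq by simp
  qed
qed

lemma pullback_of_monic:
  assumes q: "monic C q" "\<guillemotleft>q : Y \<rightarrow> Z\<guillemotright>" and s: "\<guillemotleft>s : X \<rightarrow> Y\<guillemotright>"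
  shows "is_pullback C s (Id C X) q (q \<cdot> s)"
proof (rule pullbackI[of _ X Y _ X _ Z])
  fix T h k assume h: "\<guillemotleft>h : T \<rightarrow> Y\<guillemotright>" and k: "\<guillemotleft>k : T \<rightarrow> X\<guillemotright>" and eq: "q \<cdot> h = (q \<cdot> s) \<cdot> k"
  have "s \<cdot> k = h"
    by (rule monicD[OF q _ h]) (use eq h k q s in \<open>auto simp: hom_set_def\<close>)
  then show "\<exists>u. \<guillemotleft>u : T \<rightarrow> X\<guillemotright> \<and> s \<cdot> u = h \<and> Id C X \<cdot> u = k" using k by (auto simp: hom_set_def)
qed (use q s hom_obj[OF s] in \<open>auto simp: hom_set_def\<close>)

lemma pullback_monic_self:
  assumes "monic C m" "\<guillemotleft>m : X \<rightarrow> Y\<guillemotright>"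
  shows "is_pullback C (Id C X) (Id C X) m m"
  using pullback_of_monic[OF assms, of "Id C X" X] assms hom_obj[OF assms(2)]
  by (auto simp: hom_set_def)

lemma pullback_Id:
  assumes "\<guillemotleft>f : X \<rightarrow> Y\<guillemotright>"
  shows "is_pullback C f (Id C X) (Id C Y) f"
  by (rule pullbackI[of _ X Y _ X _ Y])
    (use assms hom_obj[OF assms] in \<open>auto simp: hom_set_def\<close>)

lemma pullback_iso:
  assumes pb: "is_pullback C q r d g" and iso: "iso_arr C s" and s: "\<guillemotleft>s : Q \<rightarrow> P\<guillemotright>" and q: "\<guillemotleft>q : P \<rightarrow> Y\<guillemotright>"
  shows "is_pullback C (q \<cdot> s) (r \<cdot> s) d g"
proof -
  obtain X Z where t: "\<guillemotleft>r : P \<rightarrow> X\<guillemotright>" "\<guillemotleft>d : Y \<rightarrow> Z\<guillemotright>" "\<guillemotleft>g : X \<rightarrow> Z\<guillemotright>" "d \<cdot> q = g \<cdot> r"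
    by (rule pullbackE[OF pb]) (use q in \<open>auto simp: hom_set_def\<close>)
  obtain i where i: "\<guillemotleft>i : P \<rightarrow> Q\<guillemotright>" "i \<cdot> s = Id C Q" "s \<cdot> i = Id C P"
    using iso s by (auto simp: iso_arr_def hom_set_def)
  show ?thesis
  proof (rule pullbackI[of _ Q Y _ X _ Z])
    show "d \<cdot> q \<cdot> s = g \<cdot> r \<cdot> s" by (rule comp_eq_comp[OF t(4) q t(2,1,3) s])
  next
    fix T h k assume hk: "\<guillemotleft>h : T \<rightarrow> Y\<guillemotright>" "\<guillemotleft>k : T \<rightarrow> X\<guillemotright>" "d \<cdot> h = g \<cdot> k"
    obtain u where u: "\<guillemotleft>u : T \<rightarrow> P\<guillemotright>" "q \<cdot> u = h" "r \<cdot> u = k"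
      by (rule pullback_lift[OF pb q t(1) hk])
    have "s \<cdot> i \<cdot> u = u" using comp_eq_arr[OF i(3,1) s u(1)] u by (simp add: hom_set_def)
    then show "\<exists>u. \<guillemotleft>u : T \<rightarrow> Q\<guillemotright> \<and> (q \<cdot> s) \<cdot> u = h \<and> (r \<cdot> s) \<cdot> u = k"
      using u i s q t by (intro exI[of _ "i \<cdot> u"]) (auto simp: hom_set_def)
  next
    fix T u v assume u: "\<guillemotleft>u : T \<rightarrow> Q\<guillemotright>" and v: "\<guillemotleft>v : T \<rightarrow> Q\<guillemotright>" and
      eq: "(q \<cdot> s) \<cdot> u = (q \<cdot> s) \<cdot> v" "(r \<cdot> s) \<cdot> u = (r \<cdot> s) \<cdot> v"
    have "s \<cdot> u = s \<cdot> v"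
      by (rule pullback_jointly_monic[OF pb q]) (use eq u v s q t in \<open>auto simp: hom_set_def\<close>)
    then have "i \<cdot> s \<cdot> u = i \<cdot> s \<cdot> v" by simp
    then show "u = v" using comp_eq_arr[OF i(2) s i(1) u] comp_eq_arr[OF i(2) s i(1) v] u v
      by (simp add: hom_set_def)
  qed (use s q t in \<open>auto simp: hom_set_def\<close>)
qed

text \<open>The inverse of \<open>p\<close> is the arrow induced by \<open>Id\<close> and \<open>g\<close>. Dually, a pushout of an identity
  is invertible, and this is how all isomorphisms below are found.\<close>

lemma pullback_along_Id:
  assumes pb: "is_pullback C p q g (Id C D)"
    and D: "D \<in> Obj C"
  shows "iso_arr C p"
proof -
  obtain P A where t: "\<guillemotleft>p : P \<rightarrow> A\<guillemotright>" "\<guillemotleft>q : P \<rightarrow> D\<guillemotright>" "\<guillemotleft>g : A \<rightarrow> D\<guillemotright>" "g \<cdot> p = Id C D \<cdot> q"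
    by (rule pullbackE[OF pb]) (use D in \<open>auto simp: hom_set_def\<close>)
  obtain u where u: "\<guillemotleft>u : A \<rightarrow> P\<guillemotright>" "p \<cdot> u = Id C A" "q \<cdot> u = g"
    by (rule pullback_lift[OF pb t(1,2), of "Id C A" A g])
      (use t hom_obj[OF t(1)] in \<open>auto simp: hom_set_def\<close>)
  have "u \<cdot> p = Id C P"
  proof (rule pullback_jointly_monic[OF pb t(1)])
    show "p \<cdot> u \<cdot> p = p \<cdot> Id C P" using comp_eq_arr[OF u(2,1) t(1) t(1)] t by (simp add: hom_set_def)
    show "q \<cdot> u \<cdot> p = q \<cdot> Id C P" using comp_eq_arr[OF u(3,1) t(2) t(1)] t by (simp add: hom_set_def)
  qed (use t u hom_obj[OF t(1)] in \<open>auto simp: hom_set_def\<close>)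
  with t u show ?thesis by (auto simp: iso_arr_def hom_set_def)
qed

lemma pushoutE:
  assumes "is_pushout C m f g n"
  obtains X A B D where "\<guillemotleft>m : X \<rightarrow> A\<guillemotright>" "\<guillemotleft>f : X \<rightarrow> B\<guillemotright>" "\<guillemotleft>g : A \<rightarrow> D\<guillemotright>" "\<guillemotleft>n : B \<rightarrow> D\<guillemotright>" "g \<cdot> m = n \<cdot> f"
  using assms that[of "Dom C m" "Dom C g" "Dom C n" "Cod C g"]
  by (auto simp: is_pushout_def comm_square_def hom_set_def)

lemma pushout_swap: "is_pushout C m f g n \<Longrightarrow> is_pushout C f m n g"
  unfolding is_pushout_def comm_square_def by metis

lemmas pushout_lift =
  category.pullback_lift[OF category_opposite, unfolded opposite_simps pullback_opposite]

lemmas pushout_jointly_epic =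
  category.pullback_jointly_monic[OF category_opposite, unfolded opposite_simps pullback_opposite]

lemmas pushout_paste =
  category.pullback_paste[OF category_opposite, unfolded opposite_simps pullback_opposite]

lemmas pushout_cancel =
  category.pullback_cancel[OF category_opposite, unfolded opposite_simps pullback_opposite
    comm_square_opposite]

lemmas pushout_Id =
  category.pullback_Id[OF category_opposite, unfolded opposite_simps pullback_opposite]

lemmas pushout_iso =
  category.pullback_iso[OF category_opposite, unfolded opposite_simps pullback_opposite
    iso_opposite]

lemmas pushout_along_Id =
  category.pullback_along_Id[OF category_opposite, unfolded opposite_simps pullback_opposite
    iso_opposite]


lemma split_monic:
  assumes s: "\<guillemotleft>s : X \<rightarrow> Y\<guillemotright>" and r: "\<guillemotleft>r : Y \<rightarrow> X\<guillemotright>" "r \<cdot> s = Id C X"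
  shows "monic C s"
proof (rule monicI[OF s])
  fix T u v assume u: "\<guillemotleft>u : T \<rightarrow> X\<guillemotright>" and v: "\<guillemotleft>v : T \<rightarrow> X\<guillemotright>" and eq: "s \<cdot> u = s \<cdot> v"
  have "Id C X \<cdot> u = Id C X \<cdot> v"
    using comp_eq_arr[OF r(2) s r(1) u] comp_eq_arr[OF r(2) s r(1) v] eq by simp
  then show "u = v" using u v by (simp add: hom_set_def)
qed

lemma iso_monic: "iso_arr C s \<Longrightarrow> monic C s"
  by (auto simp: iso_arr_def hom_set_def intro: split_monic[of s "Dom C s" "Cod C s"])

text \<open>If \<open>n \<cdot> u = n \<cdot> v\<close>, then the arrows into the kernel pair induced by \<open>(u, v)\<close> and by \<open>(u, u)\<close>
  have the same first component, hence agree.\<close>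

lemma monic_of_iso_kernel_projection:
  assumes pb: "is_pullback C p q n n" and iso: "iso_arr C p"
  shows "monic C n"
proof -
  obtain K B D where t: "\<guillemotleft>p : K \<rightarrow> B\<guillemotright>" "\<guillemotleft>q : K \<rightarrow> B\<guillemotright>" "\<guillemotleft>n : B \<rightarrow> D\<guillemotright>"
    by (rule pullbackE[OF pb]) (auto simp: hom_set_def)
  show ?thesis
  proof (rule monicI[OF t(3)])
    fix T u v assume u: "\<guillemotleft>u : T \<rightarrow> B\<guillemotright>" and v: "\<guillemotleft>v : T \<rightarrow> B\<guillemotright>" and eq: "n \<cdot> u = n \<cdot> v"
    obtain w where w: "\<guillemotleft>w : T \<rightarrow> K\<guillemotright>" "p \<cdot> w = u" "q \<cdot> w = v"
      by (rule pullback_lift[OF pb t(1,2) u v eq])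
    obtain w' where w': "\<guillemotleft>w' : T \<rightarrow> K\<guillemotright>" "p \<cdot> w' = u" "q \<cdot> w' = u"
      by (rule pullback_lift[OF pb t(1,2) u u]) simp
    have "w = w'" using monicD[OF iso_monic[OF iso] t(1) w(1) w'(1)] w w' by simp
    with w w' show "u = v" by simp
  qed
qed

section \<open>Van Kampen squares are stable pullbacks\<close>

text \<open>Stability stated for a cube rather than for three pullbacks into the new vertex: the
  pullback of \<open>g \<cdot> m\<close> along \<open>d\<close> is the pasting of the left face with the front face.\<close>

lemma stable_pushout_cube:
  assumes st: "stable_pushout C m f g n"
    and front: "is_pullback C g' a d g" and right: "is_pullback C n' b d n"
    and left: "is_pullback C m' c a m" and rear: "comm_square C f' c b f"
    and top: "g' \<cdot> m' = n' \<cdot> f'"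
  shows "is_pushout C m' f' g' n'"
proof -
  have "is_pullback C (g' \<cdot> m') c d (g \<cdot> m)" by (rule pullback_paste[OF left front])
  moreover have "m' \<in> hom_set C (Dom C c) (Dom C a)" "a \<cdot> m' = m \<cdot> c"
    using left by (auto simp: is_pullback_def comm_square_def hom_set_def)
  moreover have "f' \<in> hom_set C (Dom C c) (Dom C b)" "b \<cdot> f' = f \<cdot> c"
    using rear by (auto simp: comm_square_def hom_set_def)
  ultimately show ?thesis
    using st front right top unfolding stable_pushout_def by metis
qed

text \<open>The left and back faces of a pulled back square are pullbacks by cancellation, so the
  van Kampen property applies to it.\<close>

lemma van_kampen_stable:
  assumes vk: "van_kampen C m f g n"
  shows "stable_pushout C m f g n"
  unfolding stable_pushout_def
proof (intro conjI allI impI, goal_cases)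
  case 1
  show ?case using vk by (simp add: van_kampen_def)
next
  case (2 d g' a n' b e c m' f')
  have po: "is_pushout C m f g n" using vk by (simp add: van_kampen_def)
  then have sq: "comm_square C m f g n" by (simp add: is_pushout_def)
  from 2 have front: "is_pullback C g' a d g" and right: "is_pullback C n' b d n" by auto
  from 2 have e: "is_pullback C e c d (g \<cdot> m)" and
    m': "m' \<in> hom_set C (Dom C c) (Dom C a)" "g' \<cdot> m' = e" "a \<cdot> m' = m \<cdot> c" and
    f': "f' \<in> hom_set C (Dom C c) (Dom C b)" "n' \<cdot> f' = e" "b \<cdot> f' = f \<cdot> c" by auto
  obtain X A B D where t: "\<guillemotleft>m : X \<rightarrow> A\<guillemotright>" "\<guillemotleft>f : X \<rightarrow> B\<guillemotright>" "\<guillemotleft>g : A \<rightarrow> D\<guillemotright>" "\<guillemotleft>n : B \<rightarrow> D\<guillemotright>" "g \<cdot> m = n \<cdot> f"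
    by (rule pushoutE[OF po])
  obtain A' D' where a: "\<guillemotleft>g' : A' \<rightarrow> D'\<guillemotright>" "\<guillemotleft>a : A' \<rightarrow> A\<guillemotright>" "\<guillemotleft>d : D' \<rightarrow> D\<guillemotright>"
    by (rule pullbackE[OF front]) (use t in \<open>auto simp: hom_set_def\<close>)
  obtain B' where b: "\<guillemotleft>n' : B' \<rightarrow> D'\<guillemotright>" "\<guillemotleft>b : B' \<rightarrow> B\<guillemotright>"
    by (rule pullbackE[OF right]) (use t a in \<open>auto simp: hom_set_def\<close>)
  obtain X' where c: "\<guillemotleft>c : X' \<rightarrow> X\<guillemotright>"
    by (rule pullbackE[OF e]) (use t a in \<open>auto simp: hom_set_def\<close>)
  have m'f': "\<guillemotleft>m' : X' \<rightarrow> A'\<guillemotright>" "\<guillemotleft>f' : X' \<rightarrow> B'\<guillemotright>"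
    using m'(1) f'(1) a b c by (auto simp: hom_set_def)
  have left: "is_pullback C m' c a m"
  proof (rule pullback_cancel[OF front])
    show "is_pullback C (g' \<cdot> m') c d (g \<cdot> m)" using e m' by simp
    show "comm_square C m' c a m" using t a c m'f' m'(3) by (simp add: comm_square_def hom_set_def)
  qed
  have rear: "is_pullback C f' c b f"
  proof (rule pullback_cancel[OF right])
    show "is_pullback C (n' \<cdot> f') c d (n \<cdot> f)" using e f' t by simp
    show "comm_square C f' c b f" using t b c m'f' f'(3) by (simp add: comm_square_def hom_set_def)
  qed
  have "comm_square C m' f' g' n'"
    using a b m'f' m'(2) f'(2) by (simp add: comm_square_def hom_set_def)
  then have "comm_cube C m f g n m' f' g' n' a b c d"
    using sq left rear front right by (simp add: comm_cube_def is_pullback_def)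
  then show ?case using vk left rear front right unfolding van_kampen_def by blast
qed

text \<open>In the cube with top \<open>Id f f Id\<close> and vertical maps \<open>m\<close>, \<open>Id\<close>, \<open>Id\<close>, \<open>n\<close>, the left face is a
  pullback because \<open>m\<close> is monic and the front face is the bottom square, transposed.\<close>

lemma van_kampen_pullback:
  assumes vk: "van_kampen C m f g n" and m: "monic C m"
  shows "is_pullback C m f g n"
proof -
  have po: "is_pushout C m f g n" using vk by (simp add: van_kampen_def)
  obtain X A B D where t: "\<guillemotleft>m : X \<rightarrow> A\<guillemotright>" "\<guillemotleft>f : X \<rightarrow> B\<guillemotright>" "\<guillemotleft>g : A \<rightarrow> D\<guillemotright>" "\<guillemotleft>n : B \<rightarrow> D\<guillemotright>" "g \<cdot> m = n \<cdot> f"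
    by (rule pushoutE[OF po])
  have left: "is_pullback C (Id C X) (Id C X) m m" by (rule pullback_monic_self[OF m t(1)])
  have rear: "is_pullback C f (Id C X) (Id C B) f" by (rule pullback_Id[OF t(2)])
  have top: "is_pushout C (Id C X) f f (Id C B)" by (rule pushout_Id[OF t(2)])
  have "comm_cube C m f g n (Id C X) f f (Id C B) m (Id C B) (Id C X) n"
    using t hom_obj[OF t(2)] by (simp add: comm_cube_def comm_square_def hom_set_def)
  with vk left rear top have "is_pullback C f m n g" unfolding van_kampen_def by blast
  then show ?thesis by (rule pullback_swap)
qed

end

section \<open>Stable pushouts that are pullbacks are van Kampen\<close>

locale category_with_stable_pushouts = category C for C :: "('o, 'm, 'z) category_data_scheme" (structure) +
  assumes pullbacks: "has_pullbacks C"
    and pushouts: "has_pushouts_along_monos C"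
    and stable: "\<lbrakk>monic C m; is_pushout C m f g n\<rbrakk> \<Longrightarrow> stable_pushout C m f g n"
    and pushout_pullback: "\<lbrakk>monic C m; is_pushout C m f g n\<rbrakk> \<Longrightarrow> is_pullback C m f g n"
begin

lemma obtain_pullback:
  assumes "\<guillemotleft>g : A \<rightarrow> D\<guillemotright>" "\<guillemotleft>n : B \<rightarrow> D\<guillemotright>"
  obtains P p q where "is_pullback C p q g n" "\<guillemotleft>p : P \<rightarrow> A\<guillemotright>" "\<guillemotleft>q : P \<rightarrow> B\<guillemotright>" "g \<cdot> p = n \<cdot> q"
proof -
  have "g \<in> Arr C \<and> n \<in> Arr C \<and> Cod C g = Cod C n" using assms by (simp add: hom_set_def)
  then obtain p q where pq: "is_pullback C p q g n"
    using pullbacks unfolding has_pullbacks_def by blast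
  obtain P where "\<guillemotleft>p : P \<rightarrow> A\<guillemotright>" "\<guillemotleft>q : P \<rightarrow> B\<guillemotright>" "g \<cdot> p = n \<cdot> q"
    by (rule pullbackE[OF pq]) (use assms in \<open>auto simp: hom_set_def\<close>)
  with pq that show ?thesis by blast
qed

text \<open>Pulling the square back along \<open>n\<close> turns \<open>m\<close> into an identity, because the square is a
  pullback and \<open>m\<close> is monic. Hence the pullback of \<open>n\<close> along itself, a projection of the kernel
  pair of \<open>n\<close>, is a pushout of an identity.\<close>

lemma pushout_monic:
  assumes m: "monic C m" and po: "is_pushout C m f g n"
  shows "monic C n"
proof -
  obtain X A B D where t: "\<guillemotleft>m : X \<rightarrow> A\<guillemotright>" "\<guillemotleft>f : X \<rightarrow> B\<guillemotright>" "\<guillemotleft>g : A \<rightarrow> D\<guillemotright>" "\<guillemotleft>n : B \<rightarrow> D\<guillemotright>" "g \<cdot> m = n \<cdot> f"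
    by (rule pushoutE[OF po])
  obtain K p q where K: "is_pullback C p q n n" "\<guillemotleft>p : K \<rightarrow> B\<guillemotright>" "\<guillemotleft>q : K \<rightarrow> B\<guillemotright>" "n \<cdot> p = n \<cdot> q"
    by (rule obtain_pullback[OF t(4,4)])
  obtain f' where f': "\<guillemotleft>f' : X \<rightarrow> K\<guillemotright>" "p \<cdot> f' = f" "q \<cdot> f' = f"
    by (rule pullback_lift[OF K(1-3) t(2,2)]) simp
  have "is_pushout C (Id C X) f' f p"
  proof (rule stable_pushout_cube[OF stable[OF m po]])
    show "is_pullback C f m n g" by (rule pullback_swap[OF pushout_pullback[OF m po]])
    show "is_pullback C p q n n" by (rule K(1))
    show "is_pullback C (Id C X) (Id C X) m m" by (rule pullback_monic_self[OF m t(1)])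
    show "comm_square C f' (Id C X) q f"
      using f' t K hom_obj[OF t(1)] by (simp add: comm_square_def hom_set_def)
    show "f \<cdot> Id C X = p \<cdot> f'" using f' t by (simp add: hom_set_def)
  qed
  then have "iso_arr C p" using pushout_along_Id[OF pushout_swap] hom_obj[OF t(1)] by blast
  then show ?thesis by (rule monic_of_iso_kernel_projection[OF K(1)])
qed

text \<open>Unions of subobjects are computed by pushouts. By stability the arrows \<open>j\<close> and \<open>i\<close> cover \<open>E\<close>:
  two arrows agree as soon as they agree on the part of their domain that some arrow \<open>e\<close> to \<open>E\<close>
  sends into \<open>A\<close> and on the part it sends into \<open>B\<close>. Covering both
  of two arrows into \<open>E\<close> that are identified by \<open>w\<close>, one may assume that each factors through \<open>A\<close>
  or \<open>B\<close>. If both factor through the same one, they agree because \<open>w \<cdot> j\<close> and \<open>w \<cdot> i\<close> are monic; in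
  the mixed case, they agree because both factor through the intersection \<open>X\<close>.\<close>

lemma union_monic:
  assumes m: "monic C m" and po: "is_pushout C m k j i"
    and t: "\<guillemotleft>m : X \<rightarrow> A\<guillemotright>" "\<guillemotleft>k : X \<rightarrow> B\<guillemotright>" "\<guillemotleft>j : A \<rightarrow> E\<guillemotright>" "\<guillemotleft>i : B \<rightarrow> E\<guillemotright>" "\<guillemotleft>w : E \<rightarrow> Y\<guillemotright>"
    and wj: "monic C (w \<cdot> j)" and wi: "monic C (w \<cdot> i)"
    and int: "is_pullback C m k (w \<cdot> j) (w \<cdot> i)"
  shows "monic C w"
proof (rule monicI[OF t(5)])
  have st: "stable_pushout C m k j i" by (rule stable[OF m po])
  have sq: "j \<cdot> m = i \<cdot> k" using po by (simp add: is_pushout_def comm_square_def)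
  \<comment> \<open>Arrows out of \<open>T\<close> can be compared on the two parts into which \<open>e\<close> decomposes \<open>T\<close>.\<close>
  have cover: "u = v" if uv: "\<guillemotleft>u : T \<rightarrow> S\<guillemotright>" "\<guillemotleft>v : T \<rightarrow> S\<guillemotright>" and e: "\<guillemotleft>e : T \<rightarrow> E\<guillemotright>"
    and A: "\<And>R r x. \<guillemotleft>r : R \<rightarrow> T\<guillemotright> \<Longrightarrow> \<guillemotleft>x : R \<rightarrow> A\<guillemotright> \<Longrightarrow> e \<cdot> r = j \<cdot> x \<Longrightarrow> u \<cdot> r = v \<cdot> r"
    and B: "\<And>R r x. \<guillemotleft>r : R \<rightarrow> T\<guillemotright> \<Longrightarrow> \<guillemotleft>x : R \<rightarrow> B\<guillemotright> \<Longrightarrow> e \<cdot> r = i \<cdot> x \<Longrightarrow> u \<cdot> r = v \<cdot> r"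
    for T S u v e
  proof -
    obtain P j' a where a: "is_pullback C j' a e j" "\<guillemotleft>j' : P \<rightarrow> T\<guillemotright>" "\<guillemotleft>a : P \<rightarrow> A\<guillemotright>" "e \<cdot> j' = j \<cdot> a"
      by (rule obtain_pullback[OF e t(3)])
    obtain Q i' b where b: "is_pullback C i' b e i" "\<guillemotleft>i' : Q \<rightarrow> T\<guillemotright>" "\<guillemotleft>b : Q \<rightarrow> B\<guillemotright>" "e \<cdot> i' = i \<cdot> b"
      by (rule obtain_pullback[OF e t(4)])
    obtain Z m' c where c: "is_pullback C m' c a m" "\<guillemotleft>m' : Z \<rightarrow> P\<guillemotright>" "\<guillemotleft>c : Z \<rightarrow> X\<guillemotright>" "a \<cdot> m' = m \<cdot> c"
      by (rule obtain_pullback[OF a(3) t(1)])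
    have "e \<cdot> (j' \<cdot> m') = j \<cdot> (a \<cdot> m')" by (rule comp_eq_comp[OF a(4,2) e a(3) t(3) c(2)])
    also have "\<dots> = i \<cdot> (k \<cdot> c)" using comp_eq_comp[OF sq t(1,3,2,4) c(3)] c(4) by simp
    finally obtain k' where k': "\<guillemotleft>k' : Z \<rightarrow> Q\<guillemotright>" "i' \<cdot> k' = j' \<cdot> m'" "b \<cdot> k' = k \<cdot> c"
      using pullback_lift[OF b(1-3), of "j' \<cdot> m'" Z "k \<cdot> c"] a c t by (auto simp: hom_set_def)
    have "is_pushout C m' k' j' i'"
      by (rule stable_pushout_cube[OF st a(1) b(1) c(1)])
        (use k' b c t in \<open>auto simp: comm_square_def hom_set_def\<close>)
    then show ?thesis
      by (rule pushout_jointly_epic[OF _ a(2) uv])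
        (use A[OF a(2,3,4)] B[OF b(2,3,4)] in auto)
  qed
  have mixed: "j \<cdot> x = i \<cdot> y" if xy: "\<guillemotleft>x : R \<rightarrow> A\<guillemotright>" "\<guillemotleft>y : R \<rightarrow> B\<guillemotright>" "w \<cdot> j \<cdot> x = w \<cdot> i \<cdot> y" for R x y
  proof -
    obtain z where z: "\<guillemotleft>z : R \<rightarrow> X\<guillemotright>" "m \<cdot> z = x" "k \<cdot> z = y"
      by (rule pullback_lift[OF int t(1,2) xy(1,2)]) (use xy t in \<open>auto simp: hom_set_def\<close>)
    then show ?thesis using comp_eq_comp[OF sq t(1,3,2,4) z(1)] by simp
  qed
  have ext: "w \<cdot> u \<cdot> r = w \<cdot> v \<cdot> r"
    if "w \<cdot> u = w \<cdot> v" "\<guillemotleft>u : T \<rightarrow> E\<guillemotright>" "\<guillemotleft>v : T \<rightarrow> E\<guillemotright>" "\<guillemotleft>r : R \<rightarrow> T\<guillemotright>" for T R u v r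
    by (rule comp_eq_comp[OF that(1,2) t(5) that(3) t(5) that(4)])
  have onA: "u = j \<cdot> x" if x: "\<guillemotleft>x : T \<rightarrow> A\<guillemotright>" and u: "\<guillemotleft>u : T \<rightarrow> E\<guillemotright>" and eq: "w \<cdot> u = w \<cdot> j \<cdot> x" for T u x
  proof (rule cover[OF u _ u])
    show jx: "\<guillemotleft>j \<cdot> x : T \<rightarrow> E\<guillemotright>" using x t by (auto simp: hom_set_def)
    fix R r y assume r: "\<guillemotleft>r : R \<rightarrow> T\<guillemotright>"
    have wr: "w \<cdot> u \<cdot> r = w \<cdot> j \<cdot> x \<cdot> r" using ext[OF eq u jx r] x r t by (simp add: hom_set_def)
    have xr: "\<guillemotleft>x \<cdot> r : R \<rightarrow> A\<guillemotright>" "(j \<cdot> x) \<cdot> r = j \<cdot> x \<cdot> r" using x r t by (auto simp: hom_set_def)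
    {
      assume y: "\<guillemotleft>y : R \<rightarrow> A\<guillemotright>" and ur: "u \<cdot> r = j \<cdot> y"
      have "y = x \<cdot> r"
        by (rule monicD[OF wj _ y xr(1)]) (use wr ur x y r t in \<open>auto simp: hom_set_def\<close>)
      then show "u \<cdot> r = (j \<cdot> x) \<cdot> r" using ur xr by simp
    next
      assume y: "\<guillemotleft>y : R \<rightarrow> B\<guillemotright>" and ur: "u \<cdot> r = i \<cdot> y"
      show "u \<cdot> r = (j \<cdot> x) \<cdot> r" using mixed[OF xr(1) y] wr ur xr by simp
    }
  qed
  have onB: "u = i \<cdot> x" if x: "\<guillemotleft>x : T \<rightarrow> B\<guillemotright>" and u: "\<guillemotleft>u : T \<rightarrow> E\<guillemotright>" and eq: "w \<cdot> u = w \<cdot> i \<cdot> x" for T u x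
  proof (rule cover[OF u _ u])
    show ix: "\<guillemotleft>i \<cdot> x : T \<rightarrow> E\<guillemotright>" using x t by (auto simp: hom_set_def)
    fix R r y assume r: "\<guillemotleft>r : R \<rightarrow> T\<guillemotright>"
    have wr: "w \<cdot> u \<cdot> r = w \<cdot> i \<cdot> x \<cdot> r" using ext[OF eq u ix r] x r t by (simp add: hom_set_def)
    have xr: "\<guillemotleft>x \<cdot> r : R \<rightarrow> B\<guillemotright>" "(i \<cdot> x) \<cdot> r = i \<cdot> x \<cdot> r" using x r t by (auto simp: hom_set_def)
    {
      assume y: "\<guillemotleft>y : R \<rightarrow> A\<guillemotright>" and ur: "u \<cdot> r = j \<cdot> y"
      show "u \<cdot> r = (i \<cdot> x) \<cdot> r" using mixed[OF y xr(1)] wr ur xr by simp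
    next
      assume y: "\<guillemotleft>y : R \<rightarrow> B\<guillemotright>" and ur: "u \<cdot> r = i \<cdot> y"
      have "y = x \<cdot> r"
        by (rule monicD[OF wi _ y xr(1)]) (use wr ur x y r t in \<open>auto simp: hom_set_def\<close>)
      then show "u \<cdot> r = (i \<cdot> x) \<cdot> r" using ur xr by simp
    }
  qed
  fix T u v assume u: "\<guillemotleft>u : T \<rightarrow> E\<guillemotright>" and v: "\<guillemotleft>v : T \<rightarrow> E\<guillemotright>" and eq: "w \<cdot> u = w \<cdot> v"
  show "u = v"
  proof (rule cover[OF u v v])
    fix R r x assume r: "\<guillemotleft>r : R \<rightarrow> T\<guillemotright>"
    have ur: "\<guillemotleft>u \<cdot> r : R \<rightarrow> E\<guillemotright>" using u r by (auto simp: hom_set_def)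
    have eqr: "w \<cdot> u \<cdot> r = w \<cdot> v \<cdot> r" by (rule ext[OF eq u v r])
    {
      assume "\<guillemotleft>x : R \<rightarrow> A\<guillemotright>" "v \<cdot> r = j \<cdot> x"
      then show "u \<cdot> r = v \<cdot> r" using onA[OF _ ur] eqr by simp
    next
      assume "\<guillemotleft>x : R \<rightarrow> B\<guillemotright>" "v \<cdot> r = i \<cdot> x"
      then show "u \<cdot> r = v \<cdot> r" using onB[OF _ ur] eqr by simp
    }
  qed
qed

text \<open>Pulling the square back along \<open>g\<close> makes \<open>a1 : A2 \<rightarrow> A\<close> a pushout of \<open>c1\<close> along \<open>m2\<close>. If \<open>E\<close>
  is the pushout of \<open>m\<close> and the diagonal \<open>\<gamma>\<close>, with comparison \<open>w : E \<rightarrow> A2\<close>, then \<open>a1 \<cdot> w\<close> is also a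
  pushout of \<open>c1\<close>, because \<open>c1 \<cdot> \<gamma>\<close> and \<open>a1 \<cdot> \<delta>\<close> are identities. Cancelling one pushout from the
  other leaves a pushout square with sides \<open>w\<close>, \<open>a1 \<cdot> w\<close>, \<open>a1\<close>, \<open>Id\<close>. Since \<open>w\<close> is monic as a union,
  this square is a pullback, and so \<open>w\<close> is a pullback of an identity.\<close>

lemma kernel_pair_pushout:
  assumes m: "monic C m" and po: "is_pushout C m f g n"
    and t: "\<guillemotleft>m : X \<rightarrow> A\<guillemotright>" "\<guillemotleft>f : X \<rightarrow> B\<guillemotright>" "\<guillemotleft>g : A \<rightarrow> D\<guillemotright>" "\<guillemotleft>n : B \<rightarrow> D\<guillemotright>"
    and kf: "is_pullback C c1 c2 f f" and c: "\<guillemotleft>c1 : X2 \<rightarrow> X\<guillemotright>" "\<guillemotleft>c2 : X2 \<rightarrow> X\<guillemotright>"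
    and kg: "is_pullback C a1 a2 g g" and a: "\<guillemotleft>a1 : A2 \<rightarrow> A\<guillemotright>" "\<guillemotleft>a2 : A2 \<rightarrow> A\<guillemotright>"
    and m2: "\<guillemotleft>m2 : X2 \<rightarrow> A2\<guillemotright>" "a1 \<cdot> m2 = m \<cdot> c1" "a2 \<cdot> m2 = m \<cdot> c2"
    and \<gamma>: "\<guillemotleft>\<gamma> : X \<rightarrow> X2\<guillemotright>" "c1 \<cdot> \<gamma> = Id C X" "c2 \<cdot> \<gamma> = Id C X"
    and \<delta>: "\<guillemotleft>\<delta> : A \<rightarrow> A2\<guillemotright>" "a1 \<cdot> \<delta> = Id C A" "a2 \<cdot> \<delta> = Id C A"
  shows "is_pushout C m \<gamma> \<delta> m2"
proof -
  note types = t c a m2(1) \<gamma>(1) \<delta>(1) hom_obj[OF t(1)]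
  note eqs = m2(2,3) \<gamma>(2,3) \<delta>(2,3)
  note exts = eqs[THEN comp_ext]
  have sq: "g \<cdot> m = n \<cdot> f" using po by (simp add: is_pushout_def comm_square_def)
  have pb: "is_pullback C m f g n" by (rule pushout_pullback[OF m po])
  have left: "is_pullback C m2 c2 a2 m"
  proof (rule pullback_cancel[OF kg])
    show "is_pullback C (a1 \<cdot> m2) c2 g (g \<cdot> m)"
      using pullback_paste[OF kf pb] m2 sq by simp
    show "comm_square C m2 c2 a2 m"
      using types eqs by (simp add: comm_square_def hom_set_def)
  qed
  have m2_monic: "monic C m2" by (rule monic_pullback[OF left m])
  have base: "is_pushout C m2 c1 a1 m"
  proof (rule stable_pushout_cube[OF stable[OF m po] kg pb left _ m2(2)])
    show "comm_square C c1 c2 f f" using kf by (simp add: is_pullback_def)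
  qed
  have \<delta>m: "\<delta> \<cdot> m = m2 \<cdot> \<gamma>"
    by (rule pullback_jointly_monic[OF kg a(1), of _ X])
      (use types in \<open>simp_all add: hom_set_def eqs exts\<close>)
  \<comment> \<open>The kernel pair of \<open>f\<close> meets the diagonal of \<open>A\<close> in the diagonal of \<open>X\<close>.\<close>
  have int: "is_pullback C m \<gamma> \<delta> m2"
  proof (rule pullback_swap[OF pullback_cancel[OF pullback_swap[OF left]]])
    show "is_pullback C (c2 \<cdot> \<gamma>) m m (a2 \<cdot> \<delta>)"
      unfolding \<gamma> \<delta> by (rule pullback_swap[OF pullback_Id[OF t(1)]])
    show "comm_square C \<gamma> m m2 \<delta>" using types \<delta>m by (simp add: comm_square_def hom_set_def)
  qed
  obtain j i where union: "is_pushout C m \<gamma> j i"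
    using pushouts m types unfolding has_pushouts_along_monos_def
    by (fastforce simp: hom_set_def)
  obtain E where E: "\<guillemotleft>j : A \<rightarrow> E\<guillemotright>" "\<guillemotleft>i : X2 \<rightarrow> E\<guillemotright>"
    by (rule pushoutE[OF union]) (use types in \<open>auto simp: hom_set_def\<close>)
  obtain w where w: "\<guillemotleft>w : E \<rightarrow> A2\<guillemotright>" "w \<cdot> j = \<delta>" "w \<cdot> i = m2"
    by (rule pushout_lift[OF union E \<delta>(1) m2(1) \<delta>m])
  note w_exts = w(2,3)[THEN comp_ext]
  have w_monic: "monic C w"
    by (rule union_monic[OF m union t(1) \<gamma>(1) E w(1)], unfold w)
      (rule split_monic[OF \<delta>(1) a(1) \<delta>(2)] m2_monic int)+
  have "is_pushout C i c1 (a1 \<cdot> w) m"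
  proof (rule pushout_cancel[OF union])
    have "(a1 \<cdot> w) \<cdot> j = Id C A" using types E w(1) by (simp add: hom_set_def w(2) \<delta>)
    then show "is_pushout C m (c1 \<cdot> \<gamma>) ((a1 \<cdot> w) \<cdot> j) m"
      unfolding \<gamma> using pushout_swap[OF pushout_Id[OF t(1)]] by simp
    show "comm_square C i c1 (a1 \<cdot> w) m"
      using types E w(1) by (simp add: comm_square_def hom_set_def w(3) m2)
  qed
  then have "is_pushout C (a1 \<cdot> w) w (Id C A) a1"
  proof (rule pushout_cancel[OF pushout_swap])
    have "Id C A \<cdot> m = m" using t by (simp add: hom_set_def)
    then show "is_pushout C c1 (w \<cdot> i) (Id C A \<cdot> m) a1"
      unfolding w using pushout_swap[OF base] by simp
    show "comm_square C (a1 \<cdot> w) w (Id C A) a1"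
      using types w(1) by (simp add: comm_square_def hom_set_def)
  qed
  then have "is_pullback C w (a1 \<cdot> w) a1 (Id C A)"
    by (rule pushout_pullback[OF w_monic pushout_swap])
  then have "iso_arr C w" by (rule pullback_along_Id) (use types in simp)
  from pushout_iso[OF union this w(1) E(1)] show ?thesis unfolding w .
qed

text \<open>Let \<open>Q\<close> be the pullback of \<open>n\<close> along \<open>d\<close>. As \<open>n\<close> is monic, so is \<open>q : Q \<rightarrow> D'\<close>, and pulling
  the top face back along \<open>q\<close> leaves \<open>B'\<close> and \<open>X'\<close> unchanged; the corner \<open>A'\<close> becomes
  the pullback of \<open>m\<close> along \<open>a\<close>, which is \<open>X'\<close> again.\<close>

lemma right_face_pullback:
  assumes m: "monic C m" and po: "is_pushout C m f g n"
    and cube: "comm_cube C m f g n m' f' g' n' a b c d"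
    and left: "is_pullback C m' c a m" and top: "is_pushout C m' f' g' n'"
  shows "is_pullback C n' b d n"
proof -
  obtain X A B D where t: "\<guillemotleft>m : X \<rightarrow> A\<guillemotright>" "\<guillemotleft>f : X \<rightarrow> B\<guillemotright>" "\<guillemotleft>g : A \<rightarrow> D\<guillemotright>" "\<guillemotleft>n : B \<rightarrow> D\<guillemotright>" "g \<cdot> m = n \<cdot> f"
    by (rule pushoutE[OF po])
  obtain X' A' B' D' where t': "\<guillemotleft>m' : X' \<rightarrow> A'\<guillemotright>" "\<guillemotleft>f' : X' \<rightarrow> B'\<guillemotright>" "\<guillemotleft>g' : A' \<rightarrow> D'\<guillemotright>" "\<guillemotleft>n' : B' \<rightarrow> D'\<guillemotright>"
    "g' \<cdot> m' = n' \<cdot> f'"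
    by (rule pushoutE[OF top])
  have v: "\<guillemotleft>a : A' \<rightarrow> A\<guillemotright>" "\<guillemotleft>b : B' \<rightarrow> B\<guillemotright>" "\<guillemotleft>c : X' \<rightarrow> X\<guillemotright>" "\<guillemotleft>d : D' \<rightarrow> D\<guillemotright>"
    and faces: "a \<cdot> m' = m \<cdot> c" "b \<cdot> f' = f \<cdot> c" "d \<cdot> g' = g \<cdot> a" "d \<cdot> n' = n \<cdot> b"
    using cube t t' by (auto simp: comm_cube_def comm_square_def hom_set_def)
  note types = t(1-4) t'(1-4) v hom_obj[OF t'(2)]
  have m': "monic C m'" by (rule monic_pullback[OF left m])
  obtain Q q r where Q: "is_pullback C q r d n" "\<guillemotleft>q : Q \<rightarrow> D'\<guillemotright>" "\<guillemotleft>r : Q \<rightarrow> B\<guillemotright>" "d \<cdot> q = n \<cdot> r"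
    by (rule obtain_pullback[OF v(4) t(4)])
  obtain s where s: "\<guillemotleft>s : B' \<rightarrow> Q\<guillemotright>" "q \<cdot> s = n'" "r \<cdot> s = b"
    by (rule pullback_lift[OF Q(1-3) t'(4) v(2) faces(4)])
  note exts = s(2,3)[THEN comp_ext]
  have q: "monic C q" by (rule monic_pullback[OF Q(1) pushout_monic[OF m po]])
  have "is_pushout C (Id C X') f' (s \<cdot> f') s"
  proof (rule stable_pushout_cube[OF stable[OF m' top]])
    show "is_pullback C s (Id C B') q n'"
      using pullback_of_monic[OF q Q(2) s(1)] s by simp
    show "is_pullback C (s \<cdot> f') m' q g'"
    proof (rule pullback_cancel[OF pullback_swap[OF Q(1)]])
      have "r \<cdot> s \<cdot> f' = f \<cdot> c" using types s(1) Q(3) by (simp add: exts faces hom_set_def)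
      then show "is_pullback C (r \<cdot> s \<cdot> f') m' n (d \<cdot> g')"
        using pullback_paste[OF pullback_swap[OF left] pullback_swap[OF pushout_pullback[OF m po]]] faces
        by simp
      show "comm_square C (s \<cdot> f') m' q g'"
        using types s(1) Q(2) t'(5) by (simp add: comm_square_def exts hom_set_def)
    qed
    show "is_pullback C (Id C X') (Id C X') m' m'" by (rule pullback_monic_self[OF m' t'(1)])
    show "comm_square C f' (Id C X') (Id C B') f'"
      using types by (simp add: comm_square_def hom_set_def)
    show "(s \<cdot> f') \<cdot> Id C X' = s \<cdot> f'" using types s(1) by (simp add: hom_set_def)
  qed
  then have "iso_arr C s" using pushout_along_Id[OF pushout_swap] types(13) by blast
  from pullback_iso[OF Q(1) this s(1) Q(2)] show ?thesis unfolding s .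
qed

text \<open>Let \<open>Q\<close> be the pullback of \<open>g\<close> along \<open>d\<close>. Two pushout squares are pasted: the pullback of the
  top face along \<open>q : Q \<rightarrow> D'\<close>, and the pullback along \<open>k : Y \<rightarrow> A2\<close> of the pushout
  that decomposes the kernel pair of \<open>g\<close>. Their common side is \<open>m'' : Z \<rightarrow> Y\<close>, and the outer
  square has the side \<open>z1 \<cdot> \<gamma>' = Id\<close> opposite to the comparison \<open>s : A' \<rightarrow> Q\<close>.\<close>

lemma front_face_pullback:
  assumes m: "monic C m" and po: "is_pushout C m f g n"
    and cube: "comm_cube C m f g n m' f' g' n' a b c d"
    and left: "is_pullback C m' c a m" and rear: "is_pullback C f' c b f"
    and top: "is_pushout C m' f' g' n'"
  shows "is_pullback C g' a d g"
proof -
  obtain X A B D where t: "\<guillemotleft>m : X \<rightarrow> A\<guillemotright>" "\<guillemotleft>f : X \<rightarrow> B\<guillemotright>" "\<guillemotleft>g : A \<rightarrow> D\<guillemotright>" "\<guillemotleft>n : B \<rightarrow> D\<guillemotright>" "g \<cdot> m = n \<cdot> f"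
    by (rule pushoutE[OF po])
  obtain X' A' B' D' where t': "\<guillemotleft>m' : X' \<rightarrow> A'\<guillemotright>" "\<guillemotleft>f' : X' \<rightarrow> B'\<guillemotright>" "\<guillemotleft>g' : A' \<rightarrow> D'\<guillemotright>" "\<guillemotleft>n' : B' \<rightarrow> D'\<guillemotright>"
    "g' \<cdot> m' = n' \<cdot> f'"
    by (rule pushoutE[OF top])
  have v: "\<guillemotleft>a : A' \<rightarrow> A\<guillemotright>" "\<guillemotleft>b : B' \<rightarrow> B\<guillemotright>" "\<guillemotleft>c : X' \<rightarrow> X\<guillemotright>" "\<guillemotleft>d : D' \<rightarrow> D\<guillemotright>"
    and faces: "a \<cdot> m' = m \<cdot> c" "b \<cdot> f' = f \<cdot> c" "d \<cdot> g' = g \<cdot> a" "d \<cdot> n' = n \<cdot> b"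
    using cube t t' by (auto simp: comm_cube_def comm_square_def hom_set_def)
  note types = t(1-4) t'(1-4) v hom_obj[OF t(1)] hom_obj[OF t'(1)]
  have m': "monic C m'" by (rule monic_pullback[OF left m])
  have pb: "is_pullback C m f g n" by (rule pushout_pullback[OF m po])
  obtain Q q r where Q: "is_pullback C q r d g" "\<guillemotleft>q : Q \<rightarrow> D'\<guillemotright>" "\<guillemotleft>r : Q \<rightarrow> A\<guillemotright>" "d \<cdot> q = g \<cdot> r"
    by (rule obtain_pullback[OF v(4) t(3)])
  obtain s where s: "\<guillemotleft>s : A' \<rightarrow> Q\<guillemotright>" "q \<cdot> s = g'" "r \<cdot> s = a"
    by (rule pullback_lift[OF Q(1-3) t'(3) v(1) faces(3)])
  obtain Y y1 y2 where Y: "is_pullback C y1 y2 q g'" "\<guillemotleft>y1 : Y \<rightarrow> Q\<guillemotright>" "\<guillemotleft>y2 : Y \<rightarrow> A'\<guillemotright>" "q \<cdot> y1 = g' \<cdot> y2"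
    by (rule obtain_pullback[OF Q(2) t'(3)])
  obtain Z z1 z2 where Z: "is_pullback C z1 z2 f' f'" "\<guillemotleft>z1 : Z \<rightarrow> X'\<guillemotright>" "\<guillemotleft>z2 : Z \<rightarrow> X'\<guillemotright>" "f' \<cdot> z1 = f' \<cdot> z2"
    by (rule obtain_pullback[OF t'(2,2)])
  note types' = types Q(2,3) s(1) Y(2,3) Z(2,3)
  note eqs = t'(5) faces Q(4) s(2,3) Y(4) Z(4)
  note exts = eqs[THEN comp_ext]
  obtain m'' where m'': "\<guillemotleft>m'' : Z \<rightarrow> Y\<guillemotright>" "y1 \<cdot> m'' = s \<cdot> m' \<cdot> z1" "y2 \<cdot> m'' = m' \<cdot> z2"
    by (rule pullback_lift[OF Y(1-3), of "s \<cdot> m' \<cdot> z1" Z "m' \<cdot> z2"])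
      (use types' in \<open>auto simp: hom_set_def eqs exts\<close>)
  obtain \<delta>' where \<delta>': "\<guillemotleft>\<delta>' : A' \<rightarrow> Y\<guillemotright>" "y1 \<cdot> \<delta>' = s" "y2 \<cdot> \<delta>' = Id C A'"
    by (rule pullback_lift[OF Y(1-3), of s A' "Id C A'"])
      (use types' in \<open>auto simp: hom_set_def eqs\<close>)
  obtain \<gamma>' where \<gamma>': "\<guillemotleft>\<gamma>' : X' \<rightarrow> Z\<guillemotright>" "z1 \<cdot> \<gamma>' = Id C X'" "z2 \<cdot> \<gamma>' = Id C X'"
    by (rule pullback_lift[OF Z(1-3), of "Id C X'" X' "Id C X'"])
      (use types' in \<open>auto simp: hom_set_def\<close>)
  \<comment> \<open>The corner \<open>B' \<times>\<^bsub>D'\<^esub> Q = B' \<times>\<^sub>D A\<close> is \<open>X'\<close>, since the bottom square is a pullback.\<close>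
  have right: "is_pullback C (s \<cdot> m') f' q n'"
  proof (rule pullback_cancel[OF pullback_swap[OF Q(1)]])
    have "r \<cdot> s \<cdot> m' = m \<cdot> c" using types' by (simp add: hom_set_def eqs exts)
    then show "is_pullback C (r \<cdot> s \<cdot> m') f' g (d \<cdot> n')"
      using pullback_paste[OF pullback_swap[OF rear] pb] faces by simp
    show "comm_square C (s \<cdot> m') f' q n'"
      using types' by (simp add: comm_square_def hom_set_def eqs exts)
  qed
  have over_Y: "is_pullback C m'' z2 y2 m'"
  proof (rule pullback_cancel[OF Y(1)])
    have "y1 \<cdot> m'' = (s \<cdot> m') \<cdot> z1" using types' by (simp add: hom_set_def m'')
    then show "is_pullback C (y1 \<cdot> m'') z2 q (g' \<cdot> m')"
      using pullback_paste[OF Z(1) right] t'(5) by simp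
    show "comm_square C m'' z2 y2 m'"
      using types' m'' by (simp add: comm_square_def hom_set_def)
  qed
  have Q_pushout: "is_pushout C m'' z1 y1 (s \<cdot> m')"
  proof (rule stable_pushout_cube[OF stable[OF m' top] Y(1) right over_Y])
    show "comm_square C z1 z2 f' f'" using Z(1) by (simp add: is_pullback_def)
    show "y1 \<cdot> m'' = (s \<cdot> m') \<cdot> z1" using types' by (simp add: hom_set_def m'')
  qed
  obtain X2 c1 c2 where X2: "is_pullback C c1 c2 f f" "\<guillemotleft>c1 : X2 \<rightarrow> X\<guillemotright>" "\<guillemotleft>c2 : X2 \<rightarrow> X\<guillemotright>" "f \<cdot> c1 = f \<cdot> c2"
    by (rule obtain_pullback[OF t(2,2)])
  obtain A2 a1 a2 where A2: "is_pullback C a1 a2 g g" "\<guillemotleft>a1 : A2 \<rightarrow> A\<guillemotright>" "\<guillemotleft>a2 : A2 \<rightarrow> A\<guillemotright>" "g \<cdot> a1 = g \<cdot> a2"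
    by (rule obtain_pullback[OF t(3,3)])
  obtain m2 where m2: "\<guillemotleft>m2 : X2 \<rightarrow> A2\<guillemotright>" "a1 \<cdot> m2 = m \<cdot> c1" "a2 \<cdot> m2 = m \<cdot> c2"
    by (rule pullback_lift[OF A2(1-3), of "m \<cdot> c1" X2 "m \<cdot> c2"])
      (use types X2(2-4) t(5)[THEN comp_ext] in \<open>auto simp: hom_set_def\<close>)
  obtain \<gamma> where \<gamma>: "\<guillemotleft>\<gamma> : X \<rightarrow> X2\<guillemotright>" "c1 \<cdot> \<gamma> = Id C X" "c2 \<cdot> \<gamma> = Id C X"
    by (rule pullback_lift[OF X2(1-3), of "Id C X" X "Id C X"])
      (use types in \<open>auto simp: hom_set_def\<close>)
  obtain \<delta> where \<delta>: "\<guillemotleft>\<delta> : A \<rightarrow> A2\<guillemotright>" "a1 \<cdot> \<delta> = Id C A" "a2 \<cdot> \<delta> = Id C A"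
    by (rule pullback_lift[OF A2(1-3), of "Id C A" A "Id C A"])
      (use types in \<open>auto simp: hom_set_def\<close>)
  obtain k where k: "\<guillemotleft>k : Y \<rightarrow> A2\<guillemotright>" "a1 \<cdot> k = r \<cdot> y1" "a2 \<cdot> k = a \<cdot> y2"
  proof (rule pullback_lift[OF A2(1-3), of "r \<cdot> y1" Y "a \<cdot> y2"])
    show "g \<cdot> r \<cdot> y1 = g \<cdot> a \<cdot> y2"
      using comp_eq_comp[OF Q(4,2) v(4) Q(3) t(3) Y(2)] comp_eq_comp[OF faces(3) t'(3) v(4,1) t(3) Y(3)] Y(4)
      by simp
  qed (use types' in \<open>auto simp: hom_set_def\<close>)
  obtain l where l: "\<guillemotleft>l : Z \<rightarrow> X2\<guillemotright>" "c1 \<cdot> l = c \<cdot> z1" "c2 \<cdot> l = c \<cdot> z2"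
  proof (rule pullback_lift[OF X2(1-3), of "c \<cdot> z1" Z "c \<cdot> z2"])
    show "f \<cdot> c \<cdot> z1 = f \<cdot> c \<cdot> z2"
      using comp_eq_comp[OF faces(2) t'(2) v(2,3) t(2) Z(2)] comp_eq_comp[OF faces(2) t'(2) v(2,3) t(2) Z(3)] Z(4)
      by simp
  qed (use types' in \<open>auto simp: hom_set_def\<close>)
  note types'' = types' X2(2,3) A2(2,3) m''(1) \<delta>'(1) \<gamma>'(1) m2(1) \<gamma>(1) \<delta>(1) k(1) l(1)
  note eqs' = faces(1) s(2,3) m''(2,3) \<delta>'(2,3) \<gamma>'(2,3) m2(2,3) \<gamma>(2,3) \<delta>(2,3) k(2,3) l(2,3)
  note exts' = eqs'[THEN comp_ext]
  have diag: "is_pushout C m \<gamma> \<delta> m2"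
    by (rule kernel_pair_pushout[OF m po t(1-4) X2(1-3) A2(1-3) m2 \<gamma> \<delta>])
  \<comment> \<open>\<open>Y = A' \<times>\<^sub>A A2\<close> and \<open>Z = X' \<times>\<^sub>X X2\<close>.\<close>
  have K: "is_pullback C k y2 a2 a"
  proof (rule pullback_cancel[OF A2(1)])
    show "is_pullback C (a1 \<cdot> k) y2 g (g \<cdot> a)"
      using pullback_paste[OF Y(1) pullback_swap[OF Q(1)]] k faces by simp
    show "comm_square C k y2 a2 a"
      using types'' by (simp add: comm_square_def hom_set_def k)
  qed
  have L: "is_pullback C l z2 c2 c"
  proof (rule pullback_cancel[OF X2(1)])
    show "is_pullback C (c1 \<cdot> l) z2 f (f \<cdot> c)"
      using pullback_paste[OF Z(1) pullback_swap[OF rear]] l faces by simp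
    show "comm_square C l z2 c2 c"
      using types'' by (simp add: comm_square_def hom_set_def l)
  qed
  have k\<delta>': "k \<cdot> \<delta>' = \<delta> \<cdot> a"
    by (rule pullback_jointly_monic[OF A2(1,2), of _ A'])
      (use types'' in \<open>simp_all add: hom_set_def eqs' exts'\<close>)
  have km'': "k \<cdot> m'' = m2 \<cdot> l"
    by (rule pullback_jointly_monic[OF A2(1,2), of _ Z])
      (use types'' in \<open>simp_all add: hom_set_def eqs' exts'\<close>)
  have l\<gamma>': "l \<cdot> \<gamma>' = \<gamma> \<cdot> c"
    by (rule pullback_jointly_monic[OF X2(1,2), of _ X'])
      (use types'' in \<open>simp_all add: hom_set_def eqs' exts'\<close>)
  have \<delta>'m': "\<delta>' \<cdot> m' = m'' \<cdot> \<gamma>'"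
    by (rule pullback_jointly_monic[OF Y(1,2), of _ X'])
      (use types'' in \<open>simp_all add: hom_set_def eqs' exts'\<close>)
  have "is_pushout C m' \<gamma>' \<delta>' m''"
  proof (rule stable_pushout_cube[OF stable[OF m diag] _ _ left _ \<delta>'m'])
    show "is_pullback C \<delta>' a k \<delta>"
    proof (rule pullback_cancel[OF pullback_swap[OF K]])
      show "is_pullback C (y2 \<cdot> \<delta>') a a (a2 \<cdot> \<delta>)"
        unfolding \<delta> \<delta>' by (rule pullback_swap[OF pullback_Id[OF v(1)]])
      show "comm_square C \<delta>' a k \<delta>"
        using types'' k\<delta>' by (simp add: comm_square_def hom_set_def)
    qed
    show "is_pullback C m'' l k m2"
    proof (rule pullback_cancel[OF pullback_swap[OF K]])
      show "is_pullback C (y2 \<cdot> m'') l a (a2 \<cdot> m2)"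
        unfolding m'' m2 by (rule pullback_paste[OF pullback_swap[OF L] left])
      show "comm_square C m'' l k m2"
        using types'' km'' by (simp add: comm_square_def hom_set_def)
    qed
    show "comm_square C \<gamma>' c l \<gamma>"
      using types'' l\<gamma>' by (simp add: comm_square_def hom_set_def)
  qed
  from pushout_paste[OF Q_pushout this] have "is_pushout C m' (Id C X') s (s \<cdot> m')"
    unfolding \<gamma>' \<delta>' .
  then have "iso_arr C s" by (rule pushout_along_Id) (use types in simp)
  from pullback_iso[OF Q(1) this s(1) Q(2)] show ?thesis unfolding s .
qed

lemma pushout_van_kampen:
  assumes m: "monic C m" and po: "is_pushout C m f g n"
  shows "van_kampen C m f g n"
  unfolding van_kampen_def
proof (intro conjI allI impI po)
  fix m' f' g' n' a b c d
  assume *: "comm_cube C m f g n m' f' g' n' a b c d \<and> is_pullback C m' c a m \<and> is_pullback C f' c b f"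
  then have cube: "comm_cube C m f g n m' f' g' n' a b c d"
    and left: "is_pullback C m' c a m" and rear: "is_pullback C f' c b f" by auto
  show "is_pushout C m' f' g' n' \<longleftrightarrow> is_pullback C g' a d g \<and> is_pullback C n' b d n"
  proof
    assume "is_pushout C m' f' g' n'"
    then show "is_pullback C g' a d g \<and> is_pullback C n' b d n"
      using front_face_pullback[OF m po cube left rear] right_face_pullback[OF m po cube left] by blast
  next
    assume "is_pullback C g' a d g \<and> is_pullback C n' b d n"
    then show "is_pushout C m' f' g' n'"
      using stable_pushout_cube[OF stable[OF m po] _ _ left] cube
      by (auto simp: comm_cube_def comm_square_def)
  qed
qed

end

theorem theoremA:
  fixes C :: "('o, 'm, 'z) category_data_scheme"
  assumes "category C"
    and "has_pullbacks C"
  shows "adhesive C \<longleftrightarrow>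
    has_pushouts_along_monos C \<and>
    (\<forall>m f g n. monic C m \<and> is_pushout C m f g n \<longrightarrow>
      stable_pushout C m f g n \<and> is_pullback C m f g n)"
proof
  interpret category C by fact
  assume "adhesive C"
  then show "has_pushouts_along_monos C \<and>
    (\<forall>m f g n. monic C m \<and> is_pushout C m f g n \<longrightarrow>
      stable_pushout C m f g n \<and> is_pullback C m f g n)"
    unfolding adhesive_def using van_kampen_stable van_kampen_pullback by blast
next
  assume *: "has_pushouts_along_monos C \<and>
    (\<forall>m f g n. monic C m \<and> is_pushout C m f g n \<longrightarrow>
      stable_pushout C m f g n \<and> is_pullback C m f g n)"
  interpret category_with_stable_pushouts C
    using assms * by (simp add: category_with_stable_pushouts_def category_with_stable_pushouts_axioms_def)
  show "adhesive C" unfolding adhesive_def using assms * pushout_van_kampen by blast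
qed

end
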